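(* Fix $m\in\mathbb{N}$ and $c\in[0,1]$ and let $\mu$ denote Lebesgue measure. Then there exist sequences $(A_i)_{i\in\mathbb{N}}$ and $(B_i)_{i\in\mathbb{N}}$ of Borel subsets of $[0,1]$ satisfying: (i) $\mu(A_i)>\mu(B_i)$ for all $i\in\mathbb{N}$; (ii) for any sequence of pairwise distinct natural numbers $i_1,i_2,\dots,i_l$ with $1\le l\le m$, we have \[(-1)^l\mu(A_{i_1}\cap\dots\cap A_{i_l})<(-1)^l\mu(B_{i_1}\cap\dots\cap B_{i_l});\] (iii) $\mu(\limsup_{i\to\infty}A_i)=0$; and (iv) $\mu(\limsup_{i\to\infty}B_i)=c$.
   Context: $\mathbb{N}=\{1,2,3,\dots\}$. For a sequence of sets $(A_i)_{i\in\mathbb{N}}$, $\limsup_{i\to\infty}A_i=\bigcap_{n\ge1}\bigcup_{i\ge n}A_i$ is the set of points lying in $A_i$ for infinitely many $i$. *)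

theory Defs
  imports "HOL-Analysis.Analysis"
begin

end

theory Submission
  imports Defs
begin

text \<open>
  The measures of the intersections of at most \<open>m\<close> sets do not reveal whether almost every point lies in
  only finitely many of the sets, because the sets may be strongly correlated. Suppose first that two random families
  of events are conditionally independent, each event having a random probability \<open>X\<close>, respectively
  \<open>Y\<close>. Then an intersection of \<open>k\<close> events has probability \<open>E X^k\<close>, respectively \<open>E Y^k\<close>, and any prescribed
  signs of \<open>E X^k - E Y^k\<close> for \<open>1 \<le> k \<le> m\<close> can be realised, since finitely many moments
  impose only finitely many linear conditions. For the alternating signs there is an explicit choice:
  a polynomial of degree at most \<open>m\<close> is determined by its values at \<open>0, 1/m, ..., 1\<close>, so its value at
  \<open>-1/m\<close> is a fixed signed combination of those values; for the monomial of degree \<open>k\<close> that value is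
  \<open>(-1/m)^k\<close>. The positive and the negative coefficients, rescaled, are the two mixing distributions
  (\<open>alternating_moments_at_grid\<close>).

  To make the limsup empty, cut \<open>(0,1]\<close> into the levels \<open>(1/(n+1), 1/n]\<close>, and on level \<open>n\<close> realise
  only the events with index \<open>i \<le> n\<close>. Every point then lies in finitely many of the sets. A nonempty
  intersection with largest index \<open>N\<close> lives on the levels \<open>n \<ge> N\<close>, which together have measure \<open>1/N\<close>; so
  its measure is the corresponding moment divided by \<open>N\<close> (\<open>sets_with_mixed_moments\<close>). This yields
  families \<open>A\<close> and \<open>L\<close>, with \<open>A i\<close> and \<open>L i\<close> inside \<open>U i = (0, 1/i]\<close>, that satisfy the strict inequalities
  with a margin of at least \<open>e/N\<close> for a constant \<open>e > 0\<close> (\<open>nested_sets_with_alternating_gap\<close>).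

  The numbers \<open>e/N\<close> are not summable. So there are sets \<open>E i\<close> of measure less than \<open>e/i\<close>, consisting of
  short moving intervals, that sweep over the unit interval infinitely often (\<open>sliding_intervals\<close>). Put
  \<open>B i = L i \<union> (E i \<inter> [0,c) - U i)\<close>. Removing \<open>U i\<close> ensures that a point of the nested set \<open>U N\<close> gains no
  new memberships with index up to \<open>N\<close>, so an intersection with largest index \<open>N\<close> grows by at most
  the measure of \<open>E N\<close> and all inequalities survive. Since the \<open>U i\<close> decrease to the empty set, the
  limsup of \<open>B\<close> is exactly \<open>[0,c)\<close>.
\<close>

section \<open>Exchangeable events on an interval\<close>

text \<open>
  Include each element of \<open>T\<close> independently with probability \<open>x\<close>: the sum is the probability that the
  resulting random set contains \<open>I\<close>. As an identity of polynomials it holds for every real \<open>x\<close>.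
\<close>

lemma sum_supersets_Bernoulli:
  fixes x :: real
  assumes "finite T" and "I \<subseteq> T"
  shows "(\<Sum>S | I \<subseteq> S \<and> S \<subseteq> T. x ^ card S * (1 - x) ^ (card T - card S)) = x ^ card I"
proof -
  have fin: "finite I" "finite (T - I)" using assms finite_subset by auto
  have "(\<Sum>S | I \<subseteq> S \<and> S \<subseteq> T. x ^ card S * (1 - x) ^ (card T - card S))
      = (\<Sum>R\<in>Pow (T - I). x ^ card (I \<union> R) * (1 - x) ^ (card T - card (I \<union> R)))"
    by (rule sum.reindex_bij_witness[of _ "\<lambda>R. I \<union> R" "\<lambda>S. S - I"]) (use assms in \<open>auto simp: Un_absorb1\<close>)
  also have "\<dots> = (\<Sum>R\<in>Pow (T - I). x ^ card I * ((\<Prod>i\<in>R. x) * (\<Prod>i\<in>(T - I) - R. 1 - x)))"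
  proof (rule sum.cong[OF refl])
    fix R assume "R \<in> Pow (T - I)"
    then have R: "R \<subseteq> T - I" "finite R" using fin finite_subset by auto
    have "card (I \<union> R) = card I + card R" using R fin by (intro card_Un_disjoint) auto
    moreover have "card ((T - I) - R) = card T - card I - card R"
      using R fin assms by (simp add: card_Diff_subset)
    ultimately show "x ^ card (I \<union> R) * (1 - x) ^ (card T - card (I \<union> R))
        = x ^ card I * ((\<Prod>i\<in>R. x) * (\<Prod>i\<in>(T - I) - R. 1 - x))"
      by (simp add: power_add)
  qed
  also have "\<dots> = x ^ card I * (\<Prod>i\<in>T - I. x + (1 - x))"
    using fin by (subst prod_add) (auto simp: sum_distrib_left)
  finally show ?thesis by simp
qed

text \<open>Intervals are cut off one after the other from the right end.\<close>

lemma disjoint_borel_sets_of_given_measure: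
  fixes a b :: real and w :: "'s \<Rightarrow> real"
  assumes "finite F" and "\<And>s. s \<in> F \<Longrightarrow> 0 \<le> w s" and "sum w F \<le> b - a"
  shows "\<exists>P. disjoint_family_on P F \<and>
    (\<forall>s\<in>F. P s \<in> sets borel \<and> P s \<subseteq> {a<..b} \<and> measure lborel (P s) = w s)"
  using assms
proof (induction F arbitrary: b rule: finite_induct)
  case empty
  then show ?case by (auto simp: disjoint_family_on_def)
next
  case (insert s F)
  then have "sum w F \<le> (b - w s) - a" and ws: "0 \<le> w s" by auto
  with insert.IH[of "b - w s"] insert.prems obtain P where
    P: "disjoint_family_on P F" "\<forall>t\<in>F. P t \<in> sets borel \<and> P t \<subseteq> {a<..b - w s} \<and> measure lborel (P t) = w t"
    by auto
  have "0 \<le> sum w F" using insert.prems by (intro sum_nonneg) auto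
  then have *: "a \<le> b - w s" using \<open>sum w F \<le> (b - w s) - a\<close> by linarith
  define P' where "P' = P(s := {b - w s<..b})"
  have same: "P' t = P t" if "t \<in> F" for t
    using that insert.hyps unfolding P'_def by auto
  have new: "P' s = {b - w s<..b}" unfolding P'_def by simp
  have old: "P t \<subseteq> {a<..b - w s}" if "t \<in> F" for t
    using P(2) that by simp
  have "P' s \<inter> P' t = {}" if "t \<in> F" for t
    using old[OF that] unfolding same[OF that] new by force
  then have "disjoint_family_on P' (insert s F)"
    using P(1) insert.hyps(2) by (auto simp: disjoint_family_on_insert disjoint_family_on_def same)
  moreover have "P' t \<in> sets borel \<and> P' t \<subseteq> {a<..b} \<and> measure lborel (P' t) = w t"
    if t: "t \<in> insert s F" for t
  proof (cases "t = s")
    case True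
    have "{b - w s<..b} \<subseteq> {a<..b}" using * by auto
    then show ?thesis unfolding True new using ws by simp
  next
    case False
    then have "t \<in> F" using t by simp
    moreover have "{a<..b - w s} \<subseteq> {a<..b}" using ws by auto
    ultimately show ?thesis using P(2) by (auto simp: same)
  qed
  ultimately show ?case by (intro exI[of _ P'] conjI ballI) auto
qed

text \<open>
  Finitely many events that are independent with probability \<open>x j\<close>, where \<open>j\<close> is itself drawn with weight
  \<open>W j\<close>. Only finitely many events are needed at once, so no infinite product measure has to be carried over to
  the line: it suffices to realise the law of the random index set \<open>{i. y \<in> A i}\<close>, which has finitely many
  values \<open>S\<close>, by an interval \<open>P S\<close> for each value. If the weights sum to less than one, the missing
  mass belongs to no event, which is harmless for nonempty intersections.
\<close>

lemma exchangeable_sets_in_interval: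
  fixes a b :: real and W x :: "nat \<Rightarrow> real" and T :: "'i set"
  assumes "a \<le> b" and W: "\<And>j. 0 \<le> W j" "(\<Sum>j\<le>r. W j) \<le> 1" and x: "\<And>j. j \<le> r \<Longrightarrow> 0 \<le> x j \<and> x j \<le> 1"
    and "finite T"
  shows "\<exists>A :: 'i \<Rightarrow> real set. (\<forall>i. A i \<in> sets borel \<and> A i \<subseteq> {a<..b}) \<and>
    (\<forall>I. I \<noteq> {} \<and> I \<subseteq> T \<longrightarrow> measure lborel (\<Inter>i\<in>I. A i) = (b - a) * (\<Sum>j\<le>r. W j * x j ^ card I))"
proof -
  \<comment> \<open>the law of the random index set, scaled to the length of the interval\<close>
  define w where "w S = (b - a) * (\<Sum>j\<le>r. W j * (x j ^ card S * (1 - x j) ^ (card T - card S)))" for S :: "'i set"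
  have w_sum: "(\<Sum>S | I \<subseteq> S \<and> S \<subseteq> T. w S) = (b - a) * (\<Sum>j\<le>r. W j * x j ^ card I)"
    if "I \<subseteq> T" for I
    unfolding w_def sum_distrib_left[symmetric]
    by (subst sum.swap) (simp add: sum_distrib_left[symmetric] sum_supersets_Bernoulli[OF \<open>finite T\<close> that])
  have w_pos: "0 \<le> w S" for S
    unfolding w_def using \<open>a \<le> b\<close> W x by (intro mult_nonneg_nonneg sum_nonneg) auto
  have "sum w (Pow T) = (b - a) * (\<Sum>j\<le>r. W j)"
    using w_sum[of "{}"] by (simp add: Pow_def)
  also have "\<dots> \<le> (b - a) * 1" using \<open>a \<le> b\<close> W by (intro mult_left_mono) auto
  finally obtain P where P: "disjoint_family_on P (Pow T)"
    "\<And>S. S \<subseteq> T \<Longrightarrow> P S \<in> sets borel" "\<And>S. S \<subseteq> T \<Longrightarrow> P S \<subseteq> {a<..b}"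
    "\<And>S. S \<subseteq> T \<Longrightarrow> measure lborel (P S) = w S"
    using disjoint_borel_sets_of_given_measure[of "Pow T" w b a] \<open>finite T\<close> w_pos by auto
  define A where "A i = (\<Union>S\<in>{S. i \<in> S \<and> S \<subseteq> T}. P S)" for i
  have fin: "finite {S. Q S \<and> S \<subseteq> T}" for Q
    using \<open>finite T\<close> by (rule finite_subset[rotated, OF finite_Pow_iff[THEN iffD2]]) auto
  have "measure lborel (\<Inter>i\<in>I. A i) = (b - a) * (\<Sum>j\<le>r. W j * x j ^ card I)"
    if I: "I \<noteq> {}" "I \<subseteq> T" for I
  proof -
    have "(\<Inter>i\<in>I. A i) = (\<Union>S\<in>{S. I \<subseteq> S \<and> S \<subseteq> T}. P S)"
    proof (intro equalityI subsetI)
      fix y assume y: "y \<in> (\<Inter>i\<in>I. A i)"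
      obtain i0 where "i0 \<in> I" using I by auto
      with y obtain S where S: "S \<subseteq> T" "y \<in> P S" unfolding A_def by auto
      have "i \<in> S" if "i \<in> I" for i
      proof -
        have "y \<in> A i" using y that by simp
        then obtain S' where "i \<in> S'" "S' \<subseteq> T" "y \<in> P S'" unfolding A_def by auto
        moreover have "S' = S"
        proof (rule ccontr)
          assume "S' \<noteq> S"
          then have "P S' \<inter> P S = {}"
            using P(1) \<open>S' \<subseteq> T\<close> S unfolding disjoint_family_on_def by simp
          then show False using S \<open>y \<in> P S'\<close> by blast
        qed
        ultimately show ?thesis by simp
      qed
      then show "y \<in> (\<Union>S\<in>{S. I \<subseteq> S \<and> S \<subseteq> T}. P S)" using S by auto
    qed (auto simp: A_def)
    also have "measure lborel \<dots> = (\<Sum>S | I \<subseteq> S \<and> S \<subseteq> T. measure lborel (P S))"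
    proof (rule measure_finite_Union)
      show "disjoint_family_on P {S. I \<subseteq> S \<and> S \<subseteq> T}"
        using P(1) by (rule disjoint_family_on_mono[rotated]) auto
      show "emeasure lborel (P S) \<noteq> \<infinity>" if "S \<in> {S. I \<subseteq> S \<and> S \<subseteq> T}" for S
        using emeasure_mono[of "P S" "{a<..b}" lborel] P(3)[of S] that \<open>a \<le> b\<close>
        by (auto simp: top_unique)
    qed (use fin P(2) in auto)
    also have "\<dots> = (\<Sum>S | I \<subseteq> S \<and> S \<subseteq> T. w S)"
      by (rule sum.cong) (auto simp: P(4))
    also note w_sum[OF I(2)]
    finally show ?thesis .
  qed
  then have "\<forall>I. I \<noteq> {} \<and> I \<subseteq> T \<longrightarrow> measure lborel (\<Inter>i\<in>I. A i) = (b - a) * (\<Sum>j\<le>r. W j * x j ^ card I)"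
    by (intro allI impI) (elim conjE)
  moreover have "\<forall>i. A i \<in> sets borel \<and> A i \<subseteq> {a<..b}"
  proof
    fix i
    have "A i \<in> sets borel" unfolding A_def using P(2) fin by (intro sets.finite_UN) auto
    moreover have "A i \<subseteq> {a<..b}" unfolding A_def using P(3) by (intro UN_least) auto
    ultimately show "A i \<in> sets borel \<and> A i \<subseteq> {a<..b}" ..
  qed
  ultimately show ?thesis by (intro exI[of _ A] conjI)
qed

section \<open>Events that occur finitely often\<close>

text \<open>
  On the level \<open>(1/(n+1), 1/n]\<close> only the events with index at most \<open>n\<close> are realised, so the intersection over
  \<open>I\<close> picks up the same moment, times the length of the level, on each level \<open>n \<ge> Max I\<close>, and these lengths
  telescope to \<open>1 / Max I\<close>.
\<close>

lemma sets_with_mixed_moments: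
  fixes W x :: "nat \<Rightarrow> real"
  assumes W: "\<And>j. 0 \<le> W j" "(\<Sum>j\<le>r. W j) \<le> 1" and x: "\<And>j. j \<le> r \<Longrightarrow> 0 \<le> x j \<and> x j \<le> 1"
  shows "\<exists>A :: nat \<Rightarrow> real set. (\<forall>i\<ge>1. A i \<in> sets borel \<and> A i \<subseteq> {0<..1 / real i}) \<and>
    (\<forall>I. finite I \<and> I \<noteq> {} \<and> I \<subseteq> {1..} \<longrightarrow>
      measure lborel (\<Inter>i\<in>I. A i) = (\<Sum>j\<le>r. W j * x j ^ card I) / real (Max I))"
proof -
  have "\<forall>n. \<exists>V. n \<ge> 1 \<longrightarrow> (\<forall>i. V i \<in> sets borel \<and> V i \<subseteq> {1 / real (Suc n)<..1 / real n}) \<and>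
    (\<forall>I. I \<noteq> {} \<and> I \<subseteq> {1..n} \<longrightarrow> measure lborel (\<Inter>i\<in>I. V i)
       = (1 / real n - 1 / real (Suc n)) * (\<Sum>j\<le>r. W j * x j ^ card I))"
  proof
    fix n :: nat
    show "\<exists>V. n \<ge> 1 \<longrightarrow> (\<forall>i. V i \<in> sets borel \<and> V i \<subseteq> {1 / real (Suc n)<..1 / real n}) \<and>
      (\<forall>I. I \<noteq> {} \<and> I \<subseteq> {1..n} \<longrightarrow> measure lborel (\<Inter>i\<in>I. V i)
         = (1 / real n - 1 / real (Suc n)) * (\<Sum>j\<le>r. W j * x j ^ card I))"
    proof (cases "n \<ge> 1")
      case True
      then have "1 / real (Suc n) \<le> 1 / real n" by (simp add: frac_le)
      from exchangeable_sets_in_interval[OF this W x, where T = "{1..n}"] show ?thesis by auto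
    qed auto
  qed
  then obtain V where V_all: "\<forall>n. n \<ge> 1 \<longrightarrow>
      (\<forall>i. V n i \<in> sets borel \<and> V n i \<subseteq> {1 / real (Suc n)<..1 / real n}) \<and>
      (\<forall>I. I \<noteq> {} \<and> I \<subseteq> {1..n} \<longrightarrow> measure lborel (\<Inter>i\<in>I. V n i)
         = (1 / real n - 1 / real (Suc n)) * (\<Sum>j\<le>r. W j * x j ^ card I))"
    by (rule choice[THEN exE])
  have V: "V n i \<in> sets borel" "V n i \<subseteq> {1 / real (Suc n)<..1 / real n}" if "n \<ge> 1" for n i
    using V_all that by blast+
  have V_measure: "measure lborel (\<Inter>i\<in>I. V n i)
      = (1 / real n - 1 / real (Suc n)) * (\<Sum>j\<le>r. W j * x j ^ card I)"
    if "n \<ge> 1" "I \<noteq> {}" "I \<subseteq> {1..n}" for n I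
    using V_all that by blast
  have level: "n = n'" if "y \<in> V n i" "y \<in> V n' i'" "n \<ge> 1" "n' \<ge> 1" for y n n' i i'
  proof -
    have *: "\<not> n < n'" if "1 / real (Suc n) < y" "y \<le> 1 / real n'" "n \<ge> 1" for n n'
    proof
      assume "n < n'"
      then have "1 / real n' \<le> 1 / real (Suc n)" by (intro frac_le) auto
      with that show False by linarith
    qed
    have "1 / real (Suc n) < y" "y \<le> 1 / real n" "1 / real (Suc n') < y" "y \<le> 1 / real n'"
      using V(2) that by fastforce+
    then show ?thesis using *[of n n'] *[of n' n] that by linarith
  qed
  define A where "A i = (\<Union>n\<in>{i..}. V n i)" for i
  have "A i \<in> sets borel \<and> A i \<subseteq> {0<..1 / real i}" if "i \<ge> 1" for i
  proof
    show "A i \<in> sets borel" unfolding A_def using V(1) that by (intro sets.countable_UN') auto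
    show "A i \<subseteq> {0<..1 / real i}"
    proof
      fix y assume "y \<in> A i"
      then obtain n where n: "n \<ge> i" "y \<in> V n i" unfolding A_def by auto
      then have "1 / real (Suc n) < y" "y \<le> 1 / real n" using V(2)[of n i] that by auto
      moreover have "0 \<le> 1 / real (Suc n)" "1 / real n \<le> 1 / real i" using n that by (auto intro!: frac_le)
      ultimately have "0 < y" "y \<le> 1 / real i" by linarith+
      then show "y \<in> {0<..1 / real i}" by simp
    qed
  qed
  moreover have "measure lborel (\<Inter>i\<in>I. A i) = (\<Sum>j\<le>r. W j * x j ^ card I) / real (Max I)"
    if I: "finite I" "I \<noteq> {}" "I \<subseteq> {1..}" for I
  proof -
    define N where "N = Max I"
    have N: "N \<in> I" "\<And>i. i \<in> I \<Longrightarrow> i \<le> N" using I unfolding N_def by auto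
    then have "N \<ge> 1" using I by auto
    define V' where "V' n = (\<Inter>i\<in>I. V (N + n) i)" for n
    have decomp: "(\<Inter>i\<in>I. A i) = (\<Union>n. V' n)"
    proof (intro equalityI subsetI)
      fix y assume y: "y \<in> (\<Inter>i\<in>I. A i)"
      then obtain n where n: "n \<ge> N" "y \<in> V n N" using N unfolding A_def by auto
      have "y \<in> V n i" if "i \<in> I" for i
      proof -
        have "y \<in> A i" using y that by simp
        then obtain n' where n': "n' \<ge> i" "y \<in> V n' i" unfolding A_def by auto
        moreover have "i \<ge> 1" using I that by auto
        ultimately have "n' = n" using level[of y n' i n N] n \<open>N \<ge> 1\<close> by auto
        then show ?thesis using n' by simp
      qed
      then have "y \<in> V' (n - N)" unfolding V'_def using n by simp
      then show "y \<in> (\<Union>n. V' n)" by blast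
    next
      fix y assume "y \<in> (\<Union>n. V' n)"
      then obtain n where n: "\<And>i. i \<in> I \<Longrightarrow> y \<in> V (N + n) i" unfolding V'_def by auto
      show "y \<in> (\<Inter>i\<in>I. A i)"
        unfolding A_def using n N(2)
        by (intro INT_I UN_I[of "N + n"]) (auto intro: trans_le_add1)
    qed
    have borel: "V' n \<in> sets borel" for n
      unfolding V'_def using V(1)[of "N + n"] I \<open>N \<ge> 1\<close> by (intro sets.finite_INT) auto
    have sub: "V' n \<subseteq> {0..1}" for n
    proof
      fix y assume "y \<in> V' n"
      then have "y \<in> V (N + n) N" using N unfolding V'_def by auto
      then have "1 / real (Suc (N + n)) < y" "y \<le> 1 / real (N + n)" using V(2)[of "N + n" N] \<open>N \<ge> 1\<close> by auto
      moreover have "0 \<le> 1 / real (Suc (N + n))" "1 / real (N + n) \<le> 1" using \<open>N \<ge> 1\<close> by auto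
      ultimately have "0 \<le> y" "y \<le> 1" by linarith+
      then show "y \<in> {0..1}" by simp
    qed
    have V'_sums: "(\<lambda>n. measure lborel (V' n)) sums measure lborel (\<Union>n. V' n)"
    proof (rule measure_UNION)
      show "disjoint_family V'"
        unfolding disjoint_family_on_def
      proof (intro ballI impI)
        fix n n' :: nat assume "n \<noteq> n'"
        then show "V' n \<inter> V' n' = {}"
          using level[of _ "N + n" N "N + n'" N] N \<open>N \<ge> 1\<close> unfolding V'_def by auto
      qed
      have "emeasure lborel (\<Union>n. V' n) \<le> emeasure lborel {0..1::real}"
        using sub by (intro emeasure_mono) auto
      then show "emeasure lborel (\<Union>n. V' n) \<noteq> \<infinity>" by (auto simp: top_unique)
    qed (use borel in auto)
    have V'_measure: "measure lborel (V' n) = (1 / real (N + n) - 1 / real (N + Suc n)) * (\<Sum>j\<le>r. W j * x j ^ card I)" for n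
    proof -
      have "I \<subseteq> {1..N + n}"
      proof
        fix i assume "i \<in> I"
        then show "i \<in> {1..N + n}" using I(3) N(2)[of i] by auto
      qed
      then show ?thesis unfolding V'_def using V_measure[of "N + n" I] I \<open>N \<ge> 1\<close> by simp
    qed
    have "(\<lambda>n. measure lborel (V' n)) sums ((1 / real (N + 0) - 0) * (\<Sum>j\<le>r. W j * x j ^ card I))"
      unfolding V'_measure
    proof (intro sums_mult2 telescope_sums')
      show "(\<lambda>n. 1 / real (N + n)) \<longlonglongrightarrow> 0"
        using LIMSEQ_ignore_initial_segment[OF lim_1_over_n[where 'a=real], of N] by (simp add: add.commute)
    qed
    from sums_unique2[OF V'_sums this]
    have "measure lborel (\<Union>n. V' n) = 1 / real N * (\<Sum>j\<le>r. W j * x j ^ card I)" by simp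
    then show ?thesis unfolding decomp N_def by simp
  qed
  ultimately have "(\<forall>i\<ge>1. A i \<in> sets borel \<and> A i \<subseteq> {0<..1 / real i}) \<and>
    (\<forall>I. finite I \<and> I \<noteq> {} \<and> I \<subseteq> {1..} \<longrightarrow>
      measure lborel (\<Inter>i\<in>I. A i) = (\<Sum>j\<le>r. W j * x j ^ card I) / real (Max I))"
    by simp
  then show ?thesis by (rule exI[of _ A])
qed

section \<open>Mixtures with alternating moment differences\<close>

text \<open>
  The \<open>n\<close>-th finite difference kills polynomials of degree below \<open>n\<close>: by Pascal's rule it is the \<open>(n-1)\<close>-st
  difference of a first difference, and a first difference lowers the degree.
\<close>

lemma alternating_binomial_sum_power:
  fixes a :: real
  assumes "k < n"
  shows "(\<Sum>j\<le>n. (-1) ^ j * real (n choose j) * (a + real j) ^ k) = 0"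
  using assms
proof (induction n arbitrary: k)
  case (Suc n)
  \<comment> \<open>the \<open>n\<close>-th difference operator, up to sign, evaluated at zero\<close>
  define D where "D f = (\<Sum>j\<le>n. (-1) ^ j * real (n choose j) * f j)" for f :: "nat \<Rightarrow> real"
  have lin: "D (\<lambda>j. \<Sum>i\<in>K. u i * f i j) = (\<Sum>i\<in>K. u i * D (f i))" for K :: "nat set" and u and f :: "nat \<Rightarrow> nat \<Rightarrow> real"
    unfolding D_def sum_distrib_left by (subst sum.swap) (simp add: algebra_simps)
  have pascal: "(\<Sum>j\<le>Suc n. (-1) ^ j * real (Suc n choose j) * f j) = D (\<lambda>j. f j - f (Suc j))" for f :: "nat \<Rightarrow> real"
  proof -
    have "(\<Sum>j\<le>Suc n. (-1) ^ j * real (Suc n choose j) * f j)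
       = f 0 + (\<Sum>j\<le>n. (-1) ^ Suc j * real (n choose Suc j) * f (Suc j)) - D (\<lambda>j. f (Suc j))"
      unfolding D_def
      by (subst sum.atMost_Suc_shift) (simp add: algebra_simps sum.distrib sum_negf sum_subtractf)
    also have "f 0 + (\<Sum>j\<le>n. (-1) ^ Suc j * real (n choose Suc j) * f (Suc j))
       = (\<Sum>j\<le>Suc n. (-1) ^ j * real (n choose j) * f j)"
      by (subst sum.atMost_Suc_shift) simp
    also have "\<dots> = D f" unfolding D_def by simp
    finally show ?thesis unfolding D_def by (simp add: algebra_simps sum_subtractf)
  qed
  have "(a + real j) ^ k - (a + real (Suc j)) ^ k = (\<Sum>i<k. - real (k choose i) * (a + real j) ^ i)" for j
  proof -
    have "(a + real (Suc j)) ^ k = ((a + real j) + 1) ^ k" by (simp add: algebra_simps)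
    also have "\<dots> = (\<Sum>i\<le>k. real (k choose i) * (a + real j) ^ i)" by (subst binomial_ring) simp
    also have "\<dots> = (\<Sum>i<k. real (k choose i) * (a + real j) ^ i) + (a + real j) ^ k"
      by (simp add: lessThan_Suc_atMost[symmetric])
    finally show ?thesis by (simp add: sum_negf)
  qed
  then have "D (\<lambda>j. (a + real j) ^ k - (a + real (Suc j)) ^ k)
      = (\<Sum>i<k. - real (k choose i) * D (\<lambda>j. (a + real j) ^ i))"
    by (simp only: lin)
  also have "\<dots> = 0" using Suc unfolding D_def by (intro sum.neutral) auto
  finally show ?case using pascal[of "\<lambda>j. (a + real j) ^ k"] by simp
qed simp

text \<open>
  Extrapolation from the grid \<open>0, 1/m, ..., 1\<close> to the next grid point on the left, \<open>-1/m\<close>: the \<open>(m+1)\<close>-st difference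
  over \<open>-1/m, 0, ..., 1\<close> vanishes on polynomials of degree at most \<open>m\<close>, and it is solved for its first term.
\<close>

lemma alternating_moments_at_grid:
  assumes "m \<ge> 1" and "k \<le> m"
  shows "(\<Sum>j\<le>m. (-1) ^ j * real (Suc m choose Suc j) * (real j / real m) ^ k) = (- 1 / real m) ^ k"
proof -
  have "0 = (\<Sum>j\<le>Suc m. (-1) ^ j * real (Suc m choose j) * (-1 + real j) ^ k)"
    using alternating_binomial_sum_power[of k "Suc m" "-1"] assms by simp
  also have "\<dots> = (-1) ^ k - (\<Sum>j\<le>m. (-1) ^ j * real (Suc m choose Suc j) * real j ^ k)"
    by (subst sum.atMost_Suc_shift) (simp add: sum_negf del: binomial_Suc_Suc)
  finally have "(\<Sum>j\<le>m. (-1) ^ j * real (Suc m choose Suc j) * real j ^ k) = (-1) ^ k" by simp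
  then show ?thesis
    by (simp add: power_divide sum_divide_distrib[symmetric] power_minus[of "1 / real m"] del: binomial_Suc_Suc)
qed

text \<open>
  The extrapolation coefficients are positive for even \<open>j\<close> and negative for odd \<open>j\<close>; the former are the
  mixing weights of \<open>L\<close> and the latter those of \<open>A\<close>. Their absolute values are binomial coefficients of one
  row, so division by \<open>2 ^ Suc m\<close> turns both into sub-probability weights.
\<close>

lemma nested_sets_with_alternating_gap:
  assumes "m \<ge> 1"
  shows "\<exists>A L :: nat \<Rightarrow> real set.
    (\<forall>i\<ge>1. A i \<in> sets borel \<and> A i \<subseteq> {0<..1 / real i} \<and> L i \<in> sets borel \<and> L i \<subseteq> {0<..1 / real i}) \<and>
    (\<forall>I. I \<noteq> {} \<and> I \<subseteq> {1..} \<and> finite I \<and> card I \<le> m \<longrightarrow>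
       measure lborel (\<Inter>i\<in>I. L i) - measure lborel (\<Inter>i\<in>I. A i)
         = (- 1 / real m) ^ card I / (2 ^ Suc m * real (Max I)))"
proof -
  define W where "W b j = (if even j = b then real (Suc m choose Suc j) / 2 ^ Suc m else 0)" for b j
  define M where "M b k = (\<Sum>j\<le>m. W b j * (real j / real m) ^ k)" for b k
  have "(\<Sum>j\<le>m. real (Suc m choose Suc j)) \<le> 2 ^ Suc m"
  proof -
    have "(\<Sum>j\<le>m. real (Suc m choose Suc j)) \<le> real (Suc m choose 0) + (\<Sum>j\<le>m. real (Suc m choose Suc j))"
      by simp
    also have "\<dots> = (\<Sum>j\<le>Suc m. real (Suc m choose j))"
      by (rule sum.atMost_Suc_shift[symmetric])
    also have "\<dots> = real (\<Sum>j\<le>Suc m. Suc m choose j)" by simp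
    also have "\<dots> = 2 ^ Suc m" by (subst choose_row_sum) simp
    finally show ?thesis .
  qed
  then have "(\<Sum>j\<le>m. real (Suc m choose Suc j) / 2 ^ Suc m) \<le> 1"
    by (simp add: sum_divide_distrib[symmetric] del: binomial_Suc_Suc power_Suc)
  moreover have "(\<Sum>j\<le>m. W b j) \<le> (\<Sum>j\<le>m. real (Suc m choose Suc j) / 2 ^ Suc m)" for b
    unfolding W_def by (intro sum_mono) auto
  ultimately have W: "(\<Sum>j\<le>m. W b j) \<le> 1" for b by (meson order_trans)
  have "\<exists>A :: nat \<Rightarrow> real set. (\<forall>i\<ge>1. A i \<in> sets borel \<and> A i \<subseteq> {0<..1 / real i}) \<and>
    (\<forall>I. finite I \<and> I \<noteq> {} \<and> I \<subseteq> {1..} \<longrightarrow> measure lborel (\<Inter>i\<in>I. A i) = M b (card I) / real (Max I))" for b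
    unfolding M_def by (rule sets_with_mixed_moments[OF _ W]) (auto simp: W_def divide_le_eq)
  then have "\<forall>b. \<exists>A :: nat \<Rightarrow> real set. (\<forall>i\<ge>1. A i \<in> sets borel \<and> A i \<subseteq> {0<..1 / real i}) \<and>
    (\<forall>I. finite I \<and> I \<noteq> {} \<and> I \<subseteq> {1..} \<longrightarrow> measure lborel (\<Inter>i\<in>I. A i) = M b (card I) / real (Max I))"
    by (rule allI)
  then obtain S :: "bool \<Rightarrow> nat \<Rightarrow> real set" where
    S_all: "\<forall>b. (\<forall>i\<ge>1. S b i \<in> sets borel \<and> S b i \<subseteq> {0<..1 / real i}) \<and>
    (\<forall>I. finite I \<and> I \<noteq> {} \<and> I \<subseteq> {1..} \<longrightarrow> measure lborel (\<Inter>i\<in>I. S b i) = M b (card I) / real (Max I))"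
    by (rule choice[THEN exE])
  have S: "S b i \<in> sets borel \<and> S b i \<subseteq> {0<..1 / real i}" if "i \<ge> 1" for b i
    using S_all that by blast
  have S_measure: "measure lborel (\<Inter>i\<in>I. S b i) = M b (card I) / real (Max I)"
    if "finite I" "I \<noteq> {}" "I \<subseteq> {1..}" for b I
    using S_all that by blast
  have gap: "M True k - M False k = (- 1 / real m) ^ k / 2 ^ Suc m" if "k \<le> m" for k
  proof -
    have "M True k - M False k = (\<Sum>j\<le>m. (-1) ^ j * real (Suc m choose Suc j) * (real j / real m) ^ k / 2 ^ Suc m)"
      unfolding M_def sum_subtractf[symmetric] by (intro sum.cong) (auto simp: W_def simp del: binomial_Suc_Suc power_Suc)
    then show ?thesis
      by (simp only: sum_divide_distrib[symmetric] alternating_moments_at_grid[OF assms that])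
  qed
  have "measure lborel (\<Inter>i\<in>I. S True i) - measure lborel (\<Inter>i\<in>I. S False i)
       = (- 1 / real m) ^ card I / (2 ^ Suc m * real (Max I))"
    if I: "I \<noteq> {}" "I \<subseteq> {1..}" "finite I" "card I \<le> m" for I
  proof -
    have "measure lborel (\<Inter>i\<in>I. S True i) - measure lborel (\<Inter>i\<in>I. S False i)
       = (M True (card I) - M False (card I)) / real (Max I)"
      using I by (simp add: S_measure diff_divide_distrib)
    also have "\<dots> = (- 1 / real m) ^ card I / (2 ^ Suc m * real (Max I))"
      by (simp only: gap[OF I(4)] divide_divide_eq_left)
    finally show ?thesis .
  qed
  then have "\<forall>I. I \<noteq> {} \<and> I \<subseteq> {1..} \<and> finite I \<and> card I \<le> m \<longrightarrow>
       measure lborel (\<Inter>i\<in>I. S True i) - measure lborel (\<Inter>i\<in>I. S False i)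
         = (- 1 / real m) ^ card I / (2 ^ Suc m * real (Max I))"
    by blast
  moreover have "\<forall>i\<ge>1. S False i \<in> sets borel \<and> S False i \<subseteq> {0<..1 / real i} \<and>
      S True i \<in> sets borel \<and> S True i \<subseteq> {0<..1 / real i}"
    using S by simp
  ultimately show ?thesis by (intro exI conjI)
qed

section \<open>Intervals sweeping the unit interval infinitely often\<close>

text \<open>
  Let the partial sums \<open>s i\<close> of \<open>d\<close> run along the real line, which is wrapped around the circle of length one;
  divergence makes the arcs from \<open>s i\<close> to \<open>s (Suc i)\<close> go round infinitely often. The part of an arc that
  wraps around is contained in \<open>{0..d i}\<close>; always adding this whole interval avoids a case
  distinction at the cost of the factor 2.
\<close>

lemma sliding_intervals:
  fixes d :: "nat \<Rightarrow> real"
  assumes pos: "\<And>i. 0 \<le> d i" and div: "\<not> summable d"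
  shows "\<exists>E :: nat \<Rightarrow> real set. (\<forall>i. E i \<in> sets borel \<and> E i \<subseteq> {0..1} \<and> measure lborel (E i) \<le> 2 * d i) \<and>
    (\<forall>x\<in>{0..<1}. \<forall>n. \<exists>i\<ge>n. x \<in> E i)"
proof -
  define s where "s n = (\<Sum>i<n. d i)" for n
  define E where "E i = ({frac (s i)..frac (s i) + d i} \<union> {0..d i}) \<inter> {0..1}" for i
  have meas: "measure lborel (E i) \<le> 2 * d i" for i
  proof -
    have "measure lborel (E i) \<le> measure lborel ({frac (s i)..frac (s i) + d i} \<union> {0..d i})"
      unfolding E_def
      by (intro measure_mono_fmeasurable fmeasurableI emeasure_bounded_finite) auto
    also have "\<dots> \<le> measure lborel {frac (s i)..frac (s i) + d i} + measure lborel {0..d i}"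
      by (intro measure_Un_le) auto
    finally show ?thesis using pos[of i] by simp
  qed
  have "\<exists>i\<ge>n. x \<in> E i" if x: "x \<in> {0..<1}" for x n
  proof -
    \<comment> \<open>\<open>x + z\<close> is a translate of \<open>x\<close> that the partial sums have not passed at \<open>n\<close>\<close>
    define z where "z = \<lceil>s n\<rceil>"
    have "s n \<le> x + z" using x unfolding z_def by (simp add: le_of_int_ceiling add_increasing)
    have "\<exists>k. x + z < s k"
    proof (rule ccontr)
      assume "\<nexists>k. x + z < s k"
      then have "\<forall>k. s k \<le> x + z" by (simp add: not_less)
      then have "summable d" using pos unfolding s_def by (intro summableI_nonneg_bounded[of d "x + z"]) auto
      with div show False by simp
    qed
    define k where "k = (LEAST k. x + z < s k)"
    have k: "x + z < s k" unfolding k_def using \<open>\<exists>k. x + z < s k\<close> by (rule LeastI_ex)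
    have mono: "s p \<le> s q" if "p \<le> q" for p q
      unfolding s_def using pos that by (intro sum_mono2) auto
    have "n < k" using k \<open>s n \<le> x + z\<close> mono[of k n] by (cases "n < k") auto
    then obtain i where i: "k = Suc i" "n \<le> i" by (cases k) auto
    have "\<not> x + z < s i" using not_less_Least[of i "\<lambda>k. x + z < s k"] i unfolding k_def by auto
    then have si: "s i \<le> x + z" "x + z < s i + d i" using k i by (auto simp: s_def)
    have "x \<in> E i"
    proof (cases "s i < z")
      case True
      then show ?thesis using si x unfolding E_def by auto
    next
      case False
      then have "\<lfloor>s i\<rfloor> = z" using si x by (intro floor_unique) auto
      then have "frac (s i) = s i - z" by (simp add: frac_def)
      then show ?thesis using si x unfolding E_def by auto
    qed
    then show ?thesis using i by auto
  qed
  moreover have "E i \<in> sets borel \<and> E i \<subseteq> {0..1}" for i unfolding E_def by auto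
  ultimately show ?thesis using meas by blast
qed

section \<open>The two sequences of sets\<close>

lemma in_limsup_iff: "x \<in> limsup A \<longleftrightarrow> (\<forall>n. \<exists>i\<ge>n. x \<in> A i)"
  by (auto simp: limsup_INF_SUP)

theorem theorem1p2:
  fixes m :: nat and c :: real
  assumes "m \<ge> 1" and "0 \<le> c" and "c \<le> 1"
  shows "\<exists>(A :: nat \<Rightarrow> real set) (B :: nat \<Rightarrow> real set).
    (\<forall>i\<ge>1. A i \<in> sets borel \<and> A i \<subseteq> {0..1} \<and> B i \<in> sets borel \<and> B i \<subseteq> {0..1}) \<and>
    (\<forall>i\<ge>1. measure lborel (A i) > measure lborel (B i)) \<and>
    (\<forall>is :: nat list. distinct is \<and> (\<forall>i \<in> set is. i \<ge> 1) \<and> 1 \<le> length is \<and> length is \<le> m \<longrightarrow>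
      (-1) ^ length is * measure lborel (\<Inter>i \<in> set is. A i)
        < (-1) ^ length is * measure lborel (\<Inter>i \<in> set is. B i)) \<and>
    measure lborel (limsup A) = 0 \<and>
    measure lborel (limsup B) = c"
proof -
  define U where "U i = {0<..1 / real i}" for i :: nat
  from nested_sets_with_alternating_gap[OF assms(1)] obtain A L where
    AL_all: "\<forall>i\<ge>1. A i \<in> sets borel \<and> A i \<subseteq> {0<..1 / real i} \<and> L i \<in> sets borel \<and> L i \<subseteq> {0<..1 / real i}"
    and gap_all: "\<forall>I. I \<noteq> {} \<and> I \<subseteq> {1..} \<and> finite I \<and> card I \<le> m \<longrightarrow>
       measure lborel (\<Inter>i\<in>I. L i) - measure lborel (\<Inter>i\<in>I. A i)
         = (- 1 / real m) ^ card I / (2 ^ Suc m * real (Max I))"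
    by (elim exE conjE)
  have AL: "A i \<in> sets borel" "A i \<subseteq> U i" "L i \<in> sets borel" "L i \<subseteq> U i" if "i \<ge> 1" for i
    using AL_all that unfolding U_def by simp_all
  have gap: "measure lborel (\<Inter>i\<in>I. L i) - measure lborel (\<Inter>i\<in>I. A i)
         = (- 1 / real m) ^ card I / (2 ^ Suc m * real (Max I))"
    if "I \<noteq> {}" "I \<subseteq> {1..}" "finite I" "card I \<le> m" for I
    using gap_all that by blast
  \<comment> \<open>the smallest of the gaps \<open>(1/m)^k / 2 ^ Suc m\<close>, attained at \<open>k = m\<close>\<close>
  define e where "e = (1 / real m) ^ m / 2 ^ Suc m"
  have "e > 0" using assms by (simp add: e_def)
  \<comment> \<open>division by 3 leaves \<open>2/3 < 1\<close> after the factor 2 of the sweeping intervals\<close>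
  have "\<not> summable (\<lambda>i. e / 3 * (1 / real i))"
    using \<open>e > 0\<close> not_summable_harmonic[where 'a=real] by (subst summable_cmult_iff) (auto simp: inverse_eq_divide)
  moreover have "0 \<le> e / 3 * (1 / real i)" for i using \<open>e > 0\<close> by simp
  ultimately have "\<exists>E :: nat \<Rightarrow> real set.
      (\<forall>i. E i \<in> sets borel \<and> E i \<subseteq> {0..1} \<and> measure lborel (E i) \<le> 2 * (e / 3 * (1 / real i))) \<and>
      (\<forall>x\<in>{0..<1}. \<forall>n. \<exists>i\<ge>n. x \<in> E i)"
    by (intro sliding_intervals)
  then obtain E :: "nat \<Rightarrow> real set" where
    E_all: "\<forall>i. E i \<in> sets borel \<and> E i \<subseteq> {0..1} \<and> measure lborel (E i) \<le> 2 * (e / 3 * (1 / real i))"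
      "\<forall>x\<in>{0..<1}. \<forall>n. \<exists>i\<ge>n. x \<in> E i"
    by (elim exE conjE)
  have E: "E i \<in> sets borel" "E i \<subseteq> {0..1}" "measure lborel (E i) \<le> 2 * (e / 3 * (1 / real i))" for i
    using E_all(1) by blast+
  have E_cover: "\<exists>i\<ge>n. x \<in> E i" if "x \<in> {0..<1}" for x n
    using E_all(2) that by blast
  define B where "B i = L i \<union> (E i \<inter> {0..<c} - U i)" for i
  have U01: "U i \<subseteq> {0..1}" if "i \<ge> 1" for i
  proof -
    have "1 / real i \<le> 1" using that by simp
    then show ?thesis unfolding U_def by fastforce
  qed
  have U_mono: "U j \<subseteq> U i" if "1 \<le> i" "i \<le> j" for i j
  proof -
    have "1 / real j \<le> 1 / real i" using that by (intro frac_le) auto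
    then show ?thesis unfolding U_def by auto
  qed
  have U_ev: "\<exists>n\<ge>1. \<forall>i\<ge>n. x \<notin> U i" for x
  proof (cases "x > 0")
    case True
    then obtain n where n: "n > 0" "1 / real n < x" using ex_inverse_of_nat_less[of x] by (auto simp: inverse_eq_divide)
    then have "x \<notin> U n" by (auto simp: U_def)
    then show ?thesis using U_mono[of n] n by (intro exI[of _ n]) auto
  qed (auto simp: U_def)
  have borel: "A i \<in> sets borel \<and> A i \<subseteq> {0..1} \<and> B i \<in> sets borel \<and> B i \<subseteq> {0..1}" if "i \<ge> 1" for i
    using AL[OF that] E(1,2)[of i] U01[OF that] unfolding B_def U_def by (auto intro!: sets.Un sets.Diff sets.Int)
  have main: "(-1) ^ card I * measure lborel (\<Inter>i\<in>I. A i) < (-1) ^ card I * measure lborel (\<Inter>i\<in>I. B i)"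
    if I: "I \<noteq> {}" "I \<subseteq> {1..}" "finite I" "card I \<le> m" for I
  proof -
    define N where "N = Max I"
    have N: "N \<in> I" "\<And>i. i \<in> I \<Longrightarrow> i \<le> N" using I unfolding N_def by auto
    then have "N \<ge> 1" using I by auto
    have I_ge: "i \<ge> 1" if "i \<in> I" for i using I(2) that by auto
    have Lborel: "(\<Inter>i\<in>I. L i) \<in> sets borel"
      by (intro sets.finite_INT AL(3) I_ge I)
    have Bborel: "(\<Inter>i\<in>I. B i) \<in> sets borel"
      by (intro sets.finite_INT borel[THEN conjunct2, THEN conjunct2, THEN conjunct1] I_ge I)
    have fin: "X \<in> fmeasurable lborel" if "X \<in> sets borel" "X \<subseteq> {0..1}" for X :: "real set"
      using that bounded_subset[of "{0..1}" X] by (intro fmeasurableI emeasure_bounded_finite) auto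
    have "(\<Inter>i\<in>I. L i) \<subseteq> L N" using N by auto
    then have L01: "(\<Inter>i\<in>I. L i) \<subseteq> {0..1}" using AL(4)[OF \<open>N \<ge> 1\<close>] U01[OF \<open>N \<ge> 1\<close>] by (meson order_trans)
    have "(\<Inter>i\<in>I. B i) \<subseteq> B N" using N by auto
    then have B01: "(\<Inter>i\<in>I. B i) \<subseteq> {0..1}" using borel[OF \<open>N \<ge> 1\<close>] by (meson order_trans)
    have lower: "measure lborel (\<Inter>i\<in>I. L i) \<le> measure lborel (\<Inter>i\<in>I. B i)"
      using Lborel fin[OF Bborel B01] by (intro measure_mono_fmeasurable) (auto simp: B_def)
    \<comment> \<open>a point of \<open>L N\<close> lies in every \<open>U i\<close> with \<open>i \<le> N\<close>, so it is in \<open>B i\<close> only through \<open>L i\<close>\<close>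
    have "(\<Inter>i\<in>I. B i) \<subseteq> (\<Inter>i\<in>I. L i) \<union> E N"
    proof
      fix x assume x: "x \<in> (\<Inter>i\<in>I. B i)"
      show "x \<in> (\<Inter>i\<in>I. L i) \<union> E N"
      proof (cases "x \<in> L N")
        case True
        then have "x \<in> U i" if "i \<in> I" for i
          using AL(4)[OF \<open>N \<ge> 1\<close>] U_mono[of i N] N(2)[OF that] I(2) that by auto
        then show ?thesis using x unfolding B_def by auto
      next
        case False
        then show ?thesis using x N(1) unfolding B_def by auto
      qed
    qed
    then have "measure lborel (\<Inter>i\<in>I. B i) \<le> measure lborel ((\<Inter>i\<in>I. L i) \<union> E N)"
      using Lborel Bborel L01 E(1,2) by (intro measure_mono_fmeasurable fin) auto
    also have "\<dots> \<le> measure lborel (\<Inter>i\<in>I. L i) + measure lborel (E N)"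
      using Lborel E(1) by (intro measure_Un_le) auto
    also have "measure lborel (E N) < e / real N"
      using E(3)[of N] \<open>e > 0\<close> \<open>N \<ge> 1\<close> by (simp add: field_simps)
    finally have upper: "measure lborel (\<Inter>i\<in>I. B i) < measure lborel (\<Inter>i\<in>I. L i) + e / real N" by simp
    have "(1 / real m) ^ m \<le> (1 / real m) ^ card I"
      using I(4) assms(1) by (intro power_decreasing) auto
    then have "e / real N \<le> (1 / real m) ^ card I / (2 ^ Suc m * real N)"
      unfolding e_def by (simp add: divide_right_mono del: power_Suc)
    moreover have "0 < e / real N" using \<open>e > 0\<close> \<open>N \<ge> 1\<close> by simp
    moreover have "measure lborel (\<Inter>i\<in>I. L i) - measure lborel (\<Inter>i\<in>I. A i)
       = (-1) ^ card I * ((1 / real m) ^ card I / (2 ^ Suc m * real N))"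
      using gap[OF I] power_minus[of "1 / real m" "card I"] unfolding N_def by simp
    ultimately show ?thesis using lower upper by (cases "even (card I)") auto
  qed
  have "measure lborel (B i) < measure lborel (A i)" if "i \<ge> 1" for i
    using main[of "{i}"] that assms(1) by simp
  moreover have "(-1) ^ length is * measure lborel (\<Inter>i \<in> set is. A i)
        < (-1) ^ length is * measure lborel (\<Inter>i \<in> set is. B i)"
    if "distinct is \<and> (\<forall>i \<in> set is. i \<ge> 1) \<and> 1 \<le> length is \<and> length is \<le> m" for "is"
  proof -
    have "set is \<noteq> {}" "set is \<subseteq> {1..}" "finite (set is)" "card (set is) = length is"
      using that by (auto simp: distinct_card)
    with main[of "set is"] that show ?thesis by simp
  qed
  moreover have "limsup A = {}"
  proof -
    have "x \<notin> limsup A" for x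
    proof
      assume "x \<in> limsup A"
      moreover obtain n where n: "n \<ge> 1" "\<And>i. i \<ge> n \<Longrightarrow> x \<notin> U i" using U_ev by blast
      ultimately obtain i where "i \<ge> n" "x \<in> A i" unfolding in_limsup_iff by blast
      then show False using n AL(2)[of i] by auto
    qed
    then show ?thesis by blast
  qed
  moreover have "limsup B = {0..<c}"
  proof (intro equalityI subsetI)
    fix x assume "x \<in> limsup B"
    moreover obtain n where n: "n \<ge> 1" "\<And>i. i \<ge> n \<Longrightarrow> x \<notin> U i" using U_ev by blast
    ultimately obtain i where "i \<ge> n" "x \<in> B i" unfolding in_limsup_iff by blast
    then show "x \<in> {0..<c}" using n AL(4)[of i] unfolding B_def by auto
  next
    fix x assume x: "x \<in> {0..<c}"
    obtain n where n: "\<And>i. i \<ge> n \<Longrightarrow> x \<notin> U i" using U_ev by blast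
    show "x \<in> limsup B" unfolding in_limsup_iff
    proof
      fix k
      have "x \<in> {0..<1}" using x assms(3) by auto
      then obtain i where "i \<ge> max k n" "x \<in> E i" using E_cover by blast
      then show "\<exists>i\<ge>k. x \<in> B i" using n x unfolding B_def by auto
    qed
  qed
  moreover have "measure lborel {0..<c} = c" using assms(2) by simp
  ultimately show ?thesis using borel by (intro exI[of _ A] exI[of _ B]) simp
qed

end
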